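(* Let $\mathbf{G}(s)=\mathbf{C}(s\mathbf{I}-\mathbf{A})^{-1}\mathbf{B}$ and $\widehat{\mathbf{G}}(s)=\widehat{\mathbf{C}}(s\mathbf{I}-\widehat{\mathbf{A}})^{-1}\widehat{\mathbf{B}}$ be stabilizable and detectable systems, with left-coprime factorizations $\mathbf{G}=\mathbf{M}^{-1}\mathbf{N}$ and $\widehat{\mathbf{G}}=\widehat{\mathbf{M}}^{-1}\widehat{\mathbf{N}}$ and with $\mathbf{G}_{\mathbf{F}}=[\mathbf{M},\mathbf{N}]$, $\widehat{\mathbf{G}}_{\mathbf{F}}=[\widehat{\mathbf{M}},\widehat{\mathbf{N}}]$ as defined in the context. Let $\mathbf{G}_{\mathbf{F}}$ and $\widehat{\mathbf{G}}_{\mathbf{F}}$ have the pole-residue representations $$\mathbf{G}_{\mathbf{F}}(s)=[\mathbf{I},0]+\sum_{i=1}^n\frac{\mathbf{c}_i[\mathbf{f}_i^T,\mathbf{b}_i^T]}{s-\lambda_i},\qquad \widehat{\mathbf{G}}_{\mathbf{F}}(s)=[\mathbf{I},0]+\sum_{j=1}^r\frac{\widehat{\mathbf{c}}_j[\widehat{\mathbf{f}}_j^T,\widehat{\mathbf{b}}_j^T]}{s-\widehat{\lambda}_j}$$ given in the context. Then $$\|\mathbf{G}-\widehat{\mathbf{G}}\|_{\mathcal{H}_2\text{-gap}}^2=\sum_{i=1}^n\mathbf{c}_i^T\left(\mathbf{G}_{\mathbf{F}}(-\lambda_i)-\widehat{\mathbf{G}}_{\mathbf{F}}(-\lambda_i)\right)\begin{bmatrix}\mathbf{f}_i\\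 \mathbf{b}_i\end{bmatrix}+\sum_{j=1}^r\widehat{\mathbf{c}}_j^T\left(\widehat{\mathbf{G}}_{\mathbf{F}}(-\widehat{\lambda}_j)-\mathbf{G}_{\mathbf{F}}(-\widehat{\lambda}_j)\right)\begin{bmatrix}\widehat{\mathbf{f}}_j\\ \widehat{\mathbf{b}}_j\end{bmatrix}.$$
   Context: $\mathbf{A}\in\mathbb{R}^{n\times n}$, $\mathbf{B}\in\mathbb{R}^{n\times m}$, $\mathbf{C}\in\mathbb{R}^{p\times n}$, $\widehat{\mathbf{A}}\in\mathbb{R}^{r\times r}$, $\widehat{\mathbf{B}}\in\mathbb{R}^{r\times m}$, $\widehat{\mathbf{C}}\in\mathbb{R}^{p\times r}$. "Stabilizable and detectable" means $(\mathbf{A},\mathbf{B})$ is stabilizable and $(\mathbf{A},\mathbf{C})$ is detectable (and likewise for the hatted system). Let $\mathbf{P}=\mathbf{P}^T\succeq 0$ be the solution of $\mathbf{A}\mathbf{P}+\mathbf{P}\mathbf{A}^T-\mathbf{P}\mathbf{C}^T\mathbf{C}\mathbf{P}+\mathbf{B}\mathbf{B}^T=0$, $\mathbf{F}=\mathbf{P}\mathbf{C}^T$, and $\mathbf{A}_{\mathbf{F}}=\mathbf{A}-\mathbf{F}\mathbf{C}$ (asymptotically stable). Set $\mathbf{M}(s)=\mathbf{I}-\mathbf{C}(s\mathbf{I}-\mathbf{A}_{\mathbf{F}})^{-1}\mathbf{F}$, $\mathbf{N}(s)=\mathbf{C}(s\mathbf{I}-\mathbf{A}_{\mathbf{F}})^{-1}\mathbf{B}$,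 so $\mathbf{G}=\mathbf{M}^{-1}\mathbf{N}$, and $\mathbf{G}_{\mathbf{F}}=[\mathbf{M},\mathbf{N}]$. The quantities $\widehat{\mathbf{P}},\widehat{\mathbf{F}}=\widehat{\mathbf{P}}\widehat{\mathbf{C}}^T,\widehat{\mathbf{A}}_{\widehat{\mathbf{F}}}=\widehat{\mathbf{A}}-\widehat{\mathbf{F}}\widehat{\mathbf{C}},\widehat{\mathbf{M}},\widehat{\mathbf{N}},\widehat{\mathbf{G}}_{\mathbf{F}}=[\widehat{\mathbf{M}},\widehat{\mathbf{N}}]$ are defined in the same way from $(\widehat{\mathbf{A}},\widehat{\mathbf{B}},\widehat{\mathbf{C}})$. Pole-residue data: it is assumed that the eigenvalues $\lambda_1,\dots,\lambda_n$ of $\mathbf{A}_{\mathbf{F}}$ are semi-simple (i.e. $\mathbf{A}_{\mathbf{F}}$ is diagonalizable over $\mathbb{C}$). Let $\mathbf{W}=[\mathbf{w}_1,\dots,\mathbf{w}_n]\in\mathbb{C}^{n\times n}$ be an invertible matrix of left eigenvectors, $\mathbf{w}_i^T\mathbf{A}_{\mathbf{F}}=\lambda_i\mathbf{w}_i^T$ (transpose, not conjugate transpose), and $\mathbf{V}=[\mathbf{v}_1,\dots,\mathbf{v}_n]=\mathbf{W}^{-T}$. Then $\mathbf{b}_i=\mathbf{B}^T\mathbf{w}_i$, $\mathbf{f}_i=-\mathbf{F}^T\mathbf{w}_i=-\mathbf{C}\mathbf{P}\mathbf{w}_i$, $\mathbf{c}_i=\mathbf{C}\mathbf{v}_i$.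 The data $\widehat{\lambda}_j,\widehat{\mathbf{w}}_j,\widehat{\mathbf{v}}_j,\widehat{\mathbf{b}}_j=\widehat{\mathbf{B}}^T\widehat{\mathbf{w}}_j,\widehat{\mathbf{f}}_j=-\widehat{\mathbf{F}}^T\widehat{\mathbf{w}}_j,\widehat{\mathbf{c}}_j=\widehat{\mathbf{C}}\widehat{\mathbf{v}}_j$, $j=1,\dots,r$, are defined in the same way from $\widehat{\mathbf{A}}_{\widehat{\mathbf{F}}}$, whose eigenvalues are likewise assumed semi-simple. The $\mathcal{H}_2$-gap is $\|\mathbf{G}-\widehat{\mathbf{G}}\|_{\mathcal{H}_2\text{-gap}}:=\left\|[\mathbf{M},\mathbf{N}]-[\widehat{\mathbf{M}},\widehat{\mathbf{N}}]\right\|_{\mathcal{H}_2}$, where $\|\mathbf{H}\|_{\mathcal{H}_2}=\left(\sup_{\sigma>0}\frac{1}{2\pi}\int_{-\infty}^{\infty}\|\mathbf{H}(\sigma+\imath\omega)\|_F^2\,d\omega\right)^{1/2}$. *)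

theory Defs
  imports "HOL-Analysis.Analysis"
begin

section \<open>Real state-space systems\<close>

abbreviation cmat :: "real^'n^'m \<Rightarrow> complex^'n^'m" where
  "cmat \<equiv> map_matrix complex_of_real"

definition eigenvalue :: "complex^'n^'n \<Rightarrow> complex \<Rightarrow> bool" where
  "eigenvalue X z \<longleftrightarrow> (\<exists>x. x \<noteq> 0 \<and> X *v x = z *s x)"

definition asymptotically_stable :: "real^'n^'n \<Rightarrow> bool" where
  "asymptotically_stable X \<longleftrightarrow> (\<forall>z. eigenvalue (cmat X) z \<longrightarrow> Re z < 0)"

definition stabilizable :: "real^'n^'n \<Rightarrow> real^'m^'n \<Rightarrow> bool" where
  "stabilizable A B \<longleftrightarrow> (\<exists>K :: real^'n^'m. asymptotically_stable (A - B ** K))"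

definition detectable :: "real^'n^'n \<Rightarrow> real^'n^'p \<Rightarrow> bool" where
  "detectable A C \<longleftrightarrow> (\<exists>L :: real^'p^'n. asymptotically_stable (A - L ** C))"

definition psd :: "real^'n^'n \<Rightarrow> bool" where
  "psd P \<longleftrightarrow> transpose P = P \<and> (\<forall>x. 0 \<le> x \<bullet> (P *v x))"

definition riccati_solution ::
    "real^'n^'n \<Rightarrow> real^'m^'n \<Rightarrow> real^'n^'p \<Rightarrow> real^'n^'n \<Rightarrow> bool" where
  "riccati_solution A B C P \<longleftrightarrow> psd P \<and>
     A ** P + P ** transpose A - P ** transpose C ** C ** P + B ** transpose B = 0"

text \<open>Note that \<^term>\<open>mat s\<close> is the scalar matrix with diagonal entries \<^term>\<open>s\<close>.\<close>

definition transfer ::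
    "real^'n^'n \<Rightarrow> real^'m^'n \<Rightarrow> real^'n^'p \<Rightarrow> complex \<Rightarrow> complex^'m^'p" where
  "transfer A B C s = cmat C ** matrix_inv (mat s - cmat A) ** cmat B"


section \<open>The left coprime factorization\<close>

definition gain :: "real^'n^'p \<Rightarrow> real^'n^'n \<Rightarrow> real^'p^'n" where
  "gain C P = P ** transpose C"

definition closed_loop :: "real^'n^'n \<Rightarrow> real^'n^'p \<Rightarrow> real^'n^'n \<Rightarrow> real^'n^'n" where
  "closed_loop A C P = A - gain C P ** C"

definition factor_M ::
    "real^'n^'n \<Rightarrow> real^'n^'p \<Rightarrow> real^'n^'n \<Rightarrow> complex \<Rightarrow> complex^'p^'p" where
  "factor_M A C P s =
     mat 1 - cmat C ** matrix_inv (mat s - cmat (closed_loop A C P)) ** cmat (gain C P)"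

definition factor_N ::
    "real^'n^'n \<Rightarrow> real^'m^'n \<Rightarrow> real^'n^'p \<Rightarrow> real^'n^'n \<Rightarrow> complex \<Rightarrow> complex^'m^'p" where
  "factor_N A B C P s =
     cmat C ** matrix_inv (mat s - cmat (closed_loop A C P)) ** cmat B"

definition hcat :: "'a^'k^'p \<Rightarrow> 'a^'m^'p \<Rightarrow> 'a^('k + 'm)^'p" where
  "hcat X Y = (\<chi> i j. case j of Inl k \<Rightarrow> X $ i $ k | Inr l \<Rightarrow> Y $ i $ l)"

definition vcat :: "'a^'k \<Rightarrow> 'a^'m \<Rightarrow> 'a^('k + 'm)" where
  "vcat x y = (\<chi> j. case j of Inl k \<Rightarrow> x $ k | Inr l \<Rightarrow> y $ l)"

definition factor_MN ::
    "real^'n^'n \<Rightarrow> real^'m^'n \<Rightarrow> real^'n^'p \<Rightarrow> real^'n^'n \<Rightarrow> complex \<Rightarrow> complex^('p + 'm)^'p" where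
  "factor_MN A B C P s = hcat (factor_M A C P s) (factor_N A B C P s)"


section \<open>The \<open>H\<^sub>2\<close> norm and the \<open>H\<^sub>2\<close>-gap\<close>

text \<open>
  The norm is extended-valued, so that finiteness is part of any claim about it.  The norm of the
  type \<^typ>\<open>complex^'m^'p\<close> is the Frobenius norm.
\<close>

definition h2_norm :: "(complex \<Rightarrow> complex^'m^'p) \<Rightarrow> ennreal" where
  "h2_norm H =
    (let S = (SUP \<sigma>\<in>{0<..}. ennreal (1 / (2 * pi)) *
                (\<integral>\<^sup>+\<omega>. ennreal ((norm (H (Complex \<sigma> \<omega>)))\<^sup>2) \<partial>lborel))
     in if S = \<infinity> then \<infinity> else ennreal (sqrt (enn2real S)))"

definition h2_gap ::
    "real^'n^'n \<Rightarrow> real^'m^'n \<Rightarrow> real^'n^'p \<Rightarrow> real^'n^'n \<Rightarrow>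
     real^'r^'r \<Rightarrow> real^'m^'r \<Rightarrow> real^'r^'p \<Rightarrow> real^'r^'r \<Rightarrow> ennreal" where
  "h2_gap A B C P Ah Bh Ch Ph = h2_norm (\<lambda>s. factor_MN A B C P s - factor_MN Ah Bh Ch Ph s)"


section \<open>Pole-residue data\<close>

definition left_eigenbasis :: "real^'n^'n \<Rightarrow> ('n \<Rightarrow> complex) \<Rightarrow> complex^'n^'n \<Rightarrow> bool" where
  "left_eigenbasis X lam W \<longleftrightarrow> invertible W \<and>
     (\<forall>i. column i W v* cmat X = lam i *s column i W)"

definition res_b :: "real^'m^'n \<Rightarrow> complex^'n^'n \<Rightarrow> 'n \<Rightarrow> complex^'m" where
  "res_b B W i = transpose (cmat B) *v column i W"

definition res_f :: "real^'n^'p \<Rightarrow> real^'n^'n \<Rightarrow> complex^'n^'n \<Rightarrow> 'n \<Rightarrow> complex^'p" where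
  "res_f C P W i = - (transpose (cmat (gain C P)) *v column i W)"

definition res_c :: "real^'n^'p \<Rightarrow> complex^'n^'n \<Rightarrow> 'n \<Rightarrow> complex^'p" where
  "res_c C W i = cmat C *v column i (matrix_inv (transpose W))"


section \<open>The factorization and the pole-residue form\<close>

lemma matrix_inv_cancel:
  fixes X :: "complex^'n^'n"
  assumes "invertible X"
  shows "X ** matrix_inv X = mat 1" "matrix_inv X ** X = mat 1"
  using someI_ex[of "\<lambda>Y. X ** Y = mat 1 \<and> Y ** X = mat 1"] assms
  by (auto simp: invertible_def matrix_inv_def)

lemma cmat_mult: "cmat (X ** Y) = cmat X ** cmat Y"
  by (simp add: vec_eq_iff matrix_matrix_mult_def)

lemma cmat_diff: "cmat (X - Y) = cmat X - cmat Y"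
  by (simp add: vec_eq_iff)

lemma matrix_mul_diff_right:
  fixes X :: "complex^'n^'m" and Y Z :: "complex^'k^'n"
  shows "X ** (Y - Z) = X ** Y - X ** Z"
  by (simp add: vec_eq_iff matrix_matrix_mult_def right_diff_distrib sum_subtractf)

lemma matrix_mul_diff_left:
  fixes X Y :: "complex^'n^'m" and Z :: "complex^'k^'n"
  shows "(X - Y) ** Z = X ** Z - Y ** Z"
  by (simp add: vec_eq_iff matrix_matrix_mult_def left_diff_distrib sum_subtractf)

lemma resolvent_identity:
  fixes X Y :: "complex^'n^'n"
  assumes "invertible X" "invertible Y"
  shows "matrix_inv Y ** (Y - X) ** matrix_inv X = matrix_inv X - matrix_inv Y"
proof -
  have "matrix_inv Y ** X ** matrix_inv X = matrix_inv Y"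
    by (simp add: matrix_inv_cancel assms flip: matrix_mul_assoc)
  then show ?thesis
    by (simp add: matrix_mul_diff_right matrix_mul_diff_left matrix_inv_cancel assms)
qed

lemma transfer_eq_left_factorization:
  fixes A :: "real^'n^'n" and B :: "real^'m^'n" and C :: "real^'n^'p"
  assumes X: "invertible (mat s - cmat A)"
    and Y: "invertible (mat s - cmat (closed_loop A C P))"
  shows "invertible (factor_M A C P s)"
    and "transfer A B C s = matrix_inv (factor_M A C P s) ** factor_N A B C P s"
proof -
  define X Y where "X = mat s - cmat A" and "Y = mat s - cmat (closed_loop A C P)"
  define F where "F = cmat (gain C P)"
  have YX: "F ** cmat C = Y - X"
    by (simp add: F_def X_def Y_def closed_loop_def cmat_diff cmat_mult)
  have key: "cmat C ** matrix_inv Y ** F ** (cmat C ** matrix_inv X ** Z)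
      = cmat C ** matrix_inv X ** Z - cmat C ** matrix_inv Y ** Z" for Z :: "complex^'k^'n"
  proof -
    have "cmat C ** matrix_inv Y ** F ** (cmat C ** matrix_inv X ** Z)
        = cmat C ** (matrix_inv Y ** (F ** cmat C) ** matrix_inv X) ** Z"
      by (simp add: matrix_mul_assoc)
    also have "\<dots> = cmat C ** (matrix_inv X - matrix_inv Y) ** Z"
      using X Y by (simp add: YX resolvent_identity X_def[symmetric] Y_def[symmetric])
    finally show ?thesis by (simp add: matrix_mul_diff_right matrix_mul_diff_left)
  qed
  have M: "factor_M A C P s = mat 1 - cmat C ** matrix_inv Y ** F"
    by (simp add: factor_M_def Y_def F_def)
  have "factor_M A C P s ** (mat 1 + cmat C ** matrix_inv X ** F) = mat 1"
    unfolding M by (simp add: matrix_add_ldistrib matrix_mul_diff_left key)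
  then show inv: "invertible (factor_M A C P s)"
    using invertible_right_inverse by blast
  have "factor_M A C P s ** transfer A B C s = factor_N A B C P s"
    unfolding M transfer_def factor_N_def X_def[symmetric] Y_def[symmetric]
    by (simp add: matrix_mul_diff_left key)
  then show "transfer A B C s = matrix_inv (factor_M A C P s) ** factor_N A B C P s"
    by (metis inv matrix_inv_cancel(2) matrix_mul_assoc matrix_mul_lid)
qed

lemma diagonal_matrix_mult:
  fixes d :: "'n::finite \<Rightarrow> complex" and Z :: "complex^'k^'n"
  shows "(\<chi> i j. if i = j then d i else 0) ** Z = (\<chi> i j. d i * Z $ i $ j)"
proof -
  have "(\<Sum>k\<in>UNIV. (if i = k then d i else 0) * Z $ k $ j) = d i * Z $ i $ j" for i j
    using sum.delta'[of UNIV i "\<lambda>k. d i * Z $ k $ j"]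
    by (simp add: if_distribR if_distrib[of "\<lambda>x. x * _"] cong: if_cong)
  then show ?thesis by (simp add: vec_eq_iff matrix_matrix_mult_def)
qed

lemma factor_MN_pole_residue:
  fixes A :: "real^'n^'n" and B :: "real^'m^'n" and C :: "real^'n^'p"
  assumes W: "left_eigenbasis (closed_loop A C P) lam W" and s: "\<And>i. s \<noteq> lam i"
  shows "factor_MN A B C P s $ k $ j =
    hcat (mat 1) 0 $ k $ j +
    (\<Sum>i\<in>UNIV. res_c C W i $ k * vcat (res_f C P W i) (res_b B W i) $ j / (s - lam i))"
proof -
  define X where "X = cmat (closed_loop A C P)"
  define V where "V = matrix_inv (transpose W)"
  define R where "R = (\<chi> k l. \<Sum>i\<in>UNIV. V $ k $ i * W $ l $ i / (s - lam i))"
  define D where "D = (\<chi> i j. if i = j then s - lam i else 0)"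
  define E where "E = (\<chi> i j. if i = j then 1 / (s - lam i) else 0)"
  have Wi: "invertible (transpose W)"
  proof -
    obtain U where U: "W ** U = mat 1" "U ** W = mat 1"
      using W by (auto simp: left_eigenbasis_def invertible_def)
    have "transpose W ** transpose U = mat 1"
      using U(2) matrix_transpose_mul[of U W] by simp
    then show ?thesis using invertible_right_inverse by blast
  qed
  have ev: "(\<Sum>l\<in>UNIV. W $ l $ i * X $ l $ k) = lam i * W $ k $ i" for i k
  proof -
    have "column i W v* X = lam i *s column i W"
      using W by (simp add: left_eigenbasis_def X_def)
    from arg_cong[OF this, of "\<lambda>v. v $ k"] show ?thesis
      by (simp add: vector_matrix_mult_def column_def mult.commute)
  qed
  have "transpose W ** X = (\<chi> i k. lam i * W $ k $ i)"
    by (simp add: vec_eq_iff matrix_matrix_mult_def ev transpose_def)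
  moreover have "transpose W ** mat s = (\<chi> i k. s * W $ k $ i)"
    by (simp add: vec_eq_iff matrix_matrix_mult_def transpose_def mat_def
        if_distrib if_distribR sum.delta sum.delta' mult.commute cong: if_cong)
  moreover have "D ** transpose W = (\<chi> i k. (s - lam i) * W $ k $ i)"
    by (simp add: D_def diagonal_matrix_mult vec_eq_iff transpose_def)
  ultimately have WX: "transpose W ** (mat s - X) = D ** transpose W"
    by (simp add: matrix_mul_diff_right vec_eq_iff left_diff_distrib)
  have ED: "E ** D = mat 1"
    unfolding E_def diagonal_matrix_mult using s by (simp add: vec_eq_iff D_def mat_def)
  have "E ** transpose W = (\<chi> i l. W $ l $ i / (s - lam i))"
    by (simp add: E_def diagonal_matrix_mult vec_eq_iff transpose_def)
  then have "V ** (E ** transpose W) = R"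
    by (simp add: vec_eq_iff R_def matrix_matrix_mult_def)
  then have R: "R = V ** E ** transpose W"
    by (simp add: matrix_mul_assoc)
  have "R ** (mat s - X) = V ** E ** (transpose W ** (mat s - X))"
    by (simp add: R matrix_mul_assoc)
  also have "\<dots> = V ** (E ** D) ** transpose W"
    by (simp add: WX matrix_mul_assoc)
  finally have RX: "R ** (mat s - X) = mat 1"
    by (simp add: ED V_def matrix_inv_cancel Wi)
  then have inv_sX: "invertible (mat s - X)"
    using invertible_left_inverse by blast
  have "R = R ** ((mat s - X) ** matrix_inv (mat s - X))"
    by (simp add: matrix_inv_cancel inv_sX)
  also have "\<dots> = matrix_inv (mat s - X)"
    by (simp add: matrix_mul_assoc RX)
  finally have inv: "matrix_inv (mat s - X) = R" by simp
  have CRZ: "(cmat C ** R ** Z) $ k $ j =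
      (\<Sum>i\<in>UNIV. res_c C W i $ k * (transpose Z *v column i W) $ j / (s - lam i))"
    for Z :: "complex^'q^'n" and j
  proof -
    have "cmat C ** R ** Z = (cmat C ** V) ** (E ** (transpose W ** Z))"
      by (simp add: R matrix_mul_assoc)
    also have "E ** (transpose W ** Z) =
        (\<chi> i j. (transpose W ** Z) $ i $ j / (s - lam i))"
      by (simp add: E_def diagonal_matrix_mult)
    finally have "(cmat C ** R ** Z) $ k $ j =
        (\<Sum>i\<in>UNIV. (cmat C ** V) $ k $ i * (transpose W ** Z) $ i $ j / (s - lam i))"
      by (subst (asm) matrix_matrix_mult_def) simp
    moreover have "(cmat C ** V) $ k $ i = res_c C W i $ k" for i
      by (simp add: res_c_def V_def matrix_matrix_mult_def matrix_vector_mult_def column_def)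
    moreover have "(transpose W ** Z) $ i $ j = (transpose Z *v column i W) $ j" for i
      by (simp add: matrix_matrix_mult_def matrix_vector_mult_def column_def transpose_def
          mult.commute)
    ultimately show ?thesis by simp
  qed
  show ?thesis
    by (cases j) (simp_all add: factor_MN_def hcat_def vcat_def factor_M_def factor_N_def
        X_def[symmetric] inv CRZ res_f_def res_b_def sum_negf)
qed

end

theory Submission
  imports Defs
begin

text \<open>
  Subtracting the two pole-residue forms leaves \<open>H(s) = \<Sum>\<^sub>k R\<^sub>k / (s - \<mu>\<^sub>k)\<close>, whose poles lie in the
  open left half plane: a left eigenvector of the closed loop at \<open>z\<close> with \<open>Re z \<ge> 0\<close> is, by the
  Riccati equation, annihilated by \<open>B\<close> and by the gain, which contradicts stabilizability.
  Entrywise, the integral of \<open>|H|\<^sup>2\<close> over the line \<open>Re s = \<sigma>\<close> is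
  \<open>2\<pi> \<Sum>\<^sub>k\<^sub>l R\<^sub>k cnj R\<^sub>l / (2\<sigma> - \<mu>\<^sub>k - cnj \<mu>\<^sub>l)\<close>, by an explicit primitive. It is nonincreasing in \<open>\<sigma>\<close> and
  continuous at \<open>0\<close>, so the supremum is its value at \<open>0\<close>, where summing over \<open>l\<close> gives
  \<open>\<Sum>\<^sub>k R\<^sub>k cnj (H (- cnj \<mu>\<^sub>k))\<close>; this is \<open>\<Sum>\<^sub>k R\<^sub>k H (- \<mu>\<^sub>k)\<close> because the systems are real.
\<close>

section \<open>Partial fractions on vertical lines\<close>

text \<open>Factoring out \<open>x > 0\<close> splits the logarithm as \<open>ln x\<close> plus
  \<open>Ln (a / x + \<i> * c)\<close>. The second term converges because \<open>Ln\<close> is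
  continuous at \<open>\<i>\<close> and \<open>-\<i>\<close>, away from its branch cut.\<close>

lemma Ln_vertical_asymptotics:
  fixes a :: complex and c :: real
  assumes "0 < Re a" "c = 1 \<or> c = -1"
  shows "((\<lambda>x. Ln (a + \<i> * of_real (c * x)) - of_real (ln x)) \<longlongrightarrow> \<i> * of_real (c * pi / 2)) at_top"
proof -
  have ev: "\<forall>\<^sub>F x in at_top. Ln (a / of_real x + \<i> * of_real c)
      = Ln (a + \<i> * of_real (c * x)) - of_real (ln x)"
    using eventually_gt_at_top[of 0]
  proof eventually_elim
    case (elim x)
    have "a / of_real x + \<i> * of_real c \<noteq> 0"
      using assms elim by (auto simp: complex_eq_iff)
    moreover have "a + \<i> * of_real (c * x) = of_real x * (a / of_real x + \<i> * of_real c)"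
      using elim by (simp add: field_simps)
    ultimately show ?case
      using elim by (simp add: Ln_times_of_real Ln_of_real del: of_real_mult)
  qed
  have "((\<lambda>x. a / of_real x + \<i> * of_real c) \<longlongrightarrow> 0 + \<i> * of_real c) at_top"
    by (intro tendsto_intros tendsto_divide_0[OF tendsto_const]
        filterlim_compose[OF filterlim_of_real_at_infinity] filterlim_ident)
  then have "((\<lambda>x. Ln (a / of_real x + \<i> * of_real c)) \<longlongrightarrow> Ln (0 + \<i> * of_real c)) at_top"
    using assms by (intro tendsto_Ln) (auto simp: complex_nonpos_Reals_iff)
  moreover have "Ln (0 + \<i> * of_real c) = \<i> * of_real (c * pi / 2)"
    using assms(2) by auto
  ultimately show ?thesis
    using Lim_transform_eventually[OF _ ev] by (simp only:)
qed

text \<open>With \<open>p = a + \<i> x\<close> and \<open>q = b - \<i> x\<close> the sum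
  \<open>p + q = a + b\<close> does not depend on \<open>x\<close>, so
  \<open>1 / (p q) = (1 / p + 1 / q) / (a + b)\<close> integrates to logarithms. For
  \<open>a\<close>, \<open>b\<close> in the open right half plane both arguments stay there, so the
  principal branch is smooth on the whole line.\<close>

definition line_kernel_primitive :: "complex \<Rightarrow> complex \<Rightarrow> real \<Rightarrow> complex" where
  "line_kernel_primitive a b x =
     - \<i> * (Ln (a + \<i> * of_real x) - Ln (b - \<i> * of_real x)) / (a + b)"

lemma line_kernel_primitive_has_derivative:
  assumes "0 < Re a" "0 < Re b"
  shows "(line_kernel_primitive a b has_vector_derivative
    1 / ((a + \<i> * of_real x) * (b - \<i> * of_real x))) (at x)"
proof -
  define p q where "p = a + \<i> * of_real x" and "q = b - \<i> * of_real x"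
  have pq: "p + q = a + b" by (simp add: p_def q_def)
  have nz: "p \<noteq> 0" "q \<noteq> 0" "a + b \<noteq> 0"
    using assms by (auto simp: complex_eq_iff p_def q_def)
  have "((\<lambda>z. - \<i> * (Ln (a + \<i> * z) - Ln (b - \<i> * z)) / (a + b)) has_field_derivative
      1 / ((a + \<i> * of_real x) * (b - \<i> * of_real x))) (at (of_real x))"
  proof -
    have "((\<lambda>z. - \<i> * (Ln (a + \<i> * z) - Ln (b - \<i> * z)) / (a + b)) has_field_derivative
        - \<i> * (\<i> / p + \<i> / q) / (p + q)) (at (of_real x))"
      using assms nz unfolding p_def q_def
      by (auto intro!: derivative_eq_intros simp: complex_nonpos_Reals_iff divide_inverse mult.commute)
    also have "- \<i> * (\<i> / p + \<i> / q) / (p + q) = 1 / (p * q)"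
      using nz pq[symmetric] by (simp add: divide_simps) (simp add: algebra_simps)
    finally show ?thesis by (simp add: p_def q_def)
  qed
  from has_vector_derivative_real_field[OF this] show ?thesis
    by (simp add: line_kernel_primitive_def[abs_def])
qed

text \<open>The divergent \<open>ln x\<close> is common to both logarithms and cancels. What remains
  is the difference of the arguments \<open>pi / 2\<close> and \<open>- pi / 2\<close>.\<close>

lemma line_kernel_primitive_at_top:
  assumes "0 < Re a" "0 < Re b"
  shows "(line_kernel_primitive a b \<longlongrightarrow> of_real pi / (a + b)) at_top"
proof -
  have "((\<lambda>x. - \<i> * ((Ln (a + \<i> * of_real (1 * x)) - of_real (ln x))
      - (Ln (b + \<i> * of_real (-1 * x)) - of_real (ln x))) / (a + b))
      \<longlongrightarrow> - \<i> * (\<i> * of_real (1 * pi / 2) - \<i> * of_real (-1 * pi / 2)) / (a + b)) at_top"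
    using assms by (intro tendsto_intros Ln_vertical_asymptotics) (auto simp: complex_eq_iff)
  then show ?thesis by (simp add: line_kernel_primitive_def[abs_def] algebra_simps)
qed

lemma line_kernel_primitive_at_bot:
  assumes "0 < Re a" "0 < Re b"
  shows "(line_kernel_primitive a b \<longlongrightarrow> - of_real pi / (a + b)) at_bot"
proof -
  \<comment> \<open>Reflecting the line exchanges \<open>a\<close> and \<open>b\<close>, so the
    limit at \<open>at_bot\<close> reduces to the one at \<open>at_top\<close>.\<close>
  have "line_kernel_primitive a b (- x) = - line_kernel_primitive b a x" for x
    by (simp add: line_kernel_primitive_def algebra_simps diff_divide_distrib)
  then show ?thesis
    using tendsto_minus[OF line_kernel_primitive_at_top[OF assms(2,1)]]
    by (simp add: filterlim_at_bot_mirror add.commute)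
qed

text \<open>For a nonnegative integrand, finite limits of the primitive give integrability as well
  as the value.\<close>

lemma has_bochner_integral_FTC_real_line:
  fixes f F :: "real \<Rightarrow> real"
  assumes "\<And>x. (F has_real_derivative f x) (at x)" "\<And>x. isCont f x" "\<And>x. 0 \<le> f x"
    and "(F \<longlongrightarrow> a) at_bot" "(F \<longlongrightarrow> b) at_top"
  shows "has_bochner_integral lborel f (b - a)"
proof -
  have "set_integrable lborel (einterval (-\<infinity>) \<infinity>) f" "(LBINT x=-\<infinity>..\<infinity>. f x) = b - a"
    by (rule interval_integral_FTC_nonneg[of "-\<infinity>" "\<infinity>" F f a b];
        use assms in \<open>simp add: ereal_tendsto_simps\<close>)+
  then show ?thesis
    by (simp add: has_bochner_integral_iff set_integrable_def interval_lebesgue_integral_def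
        set_lebesgue_integral_def einterval_def)
qed

section \<open>Energy of a partial fraction on a vertical line\<close>

lemma norm_sum_power2:
  "complex_of_real ((norm (\<Sum>k\<in>K. f k))\<^sup>2) = (\<Sum>k\<in>K. \<Sum>l\<in>K. f k * cnj (f l))"
  by (simp only: complex_norm_square cnj_sum sum_product)

lemma norm_sum_power2_Re:
  "(norm (\<Sum>k\<in>K. f k))\<^sup>2 = Re (\<Sum>k\<in>K. \<Sum>l\<in>K. f k * cnj (f l))"
  by (metis norm_sum_power2 Re_complex_of_real)

text \<open>The square expands into kernels with parameters \<open>a k\<close> and
  \<open>cnj (a l)\<close>, each contributing \<open>2 pi / (a k + cnj (a l))\<close>. The single
  terms are complex, so the fundamental theorem is applied to the real part of the whole double sum,
  whose derivative is a square.\<close>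

lemma has_bochner_integral_norm_partial_fractions:
  fixes R a :: "'k \<Rightarrow> complex"
  assumes a: "\<And>k. k \<in> K \<Longrightarrow> 0 < Re (a k)"
  shows "has_bochner_integral lborel (\<lambda>x. (norm (\<Sum>k\<in>K. R k / (a k + \<i> * of_real x)))\<^sup>2)
    (2 * pi * Re (\<Sum>k\<in>K. \<Sum>l\<in>K. R k * cnj (R l) / (a k + cnj (a l))))"
proof -
  define F where "F x = Re (\<Sum>k\<in>K. \<Sum>l\<in>K. R k * cnj (R l) *
    line_kernel_primitive (a k) (cnj (a l)) x)" for x
  define S where "S = Re (\<Sum>k\<in>K. \<Sum>l\<in>K. R k * cnj (R l) / (a k + cnj (a l)))"
  have Re_pi: "Re (c * (of_real pi / d)) = pi * Re (c / d)" for c d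
  proof -
    have "c * (of_real pi / d) = of_real pi * (c / d)" by simp
    then show ?thesis by (simp only: scaleR_complex.sel flip: scaleR_conv_of_real)
  qed
  have top: "(F \<longlongrightarrow> Re (\<Sum>k\<in>K. \<Sum>l\<in>K. R k * cnj (R l) * (of_real pi / (a k + cnj (a l))))) at_top"
    unfolding F_def[abs_def] using a
    by (intro tendsto_Re tendsto_sum tendsto_mult tendsto_const line_kernel_primitive_at_top) auto
  have bot: "(F \<longlongrightarrow> Re (\<Sum>k\<in>K. \<Sum>l\<in>K. R k * cnj (R l) * (- of_real pi / (a k + cnj (a l))))) at_bot"
    unfolding F_def[abs_def] using a
    by (intro tendsto_Re tendsto_sum tendsto_mult tendsto_const line_kernel_primitive_at_bot) auto
  have deriv: "(F has_real_derivative (norm (\<Sum>k\<in>K. R k / (a k + \<i> * of_real x)))\<^sup>2) (at x)" for x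
  proof -
    have "((\<lambda>x. \<Sum>k\<in>K. \<Sum>l\<in>K. R k * cnj (R l) * line_kernel_primitive (a k) (cnj (a l)) x)
      has_vector_derivative (\<Sum>k\<in>K. \<Sum>l\<in>K. R k * cnj (R l) *
        (1 / ((a k + \<i> * of_real x) * (cnj (a l) - \<i> * of_real x))))) (at x)"
      using a
      by (intro has_vector_derivative_sum has_vector_derivative_mult_right
          line_kernel_primitive_has_derivative) auto
    then have "(F has_vector_derivative Re (\<Sum>k\<in>K. \<Sum>l\<in>K. R k * cnj (R l) *
        (1 / ((a k + \<i> * of_real x) * (cnj (a l) - \<i> * of_real x))))) (at x)"
      unfolding F_def[abs_def]
      by (rule bounded_linear.has_vector_derivative[OF bounded_linear_Re])
    then show ?thesis
      by (simp add: has_real_derivative_iff_has_vector_derivative norm_sum_power2_Re)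
  qed
  have "isCont (\<lambda>x. (norm (\<Sum>k\<in>K. R k / (a k + \<i> * of_real x)))\<^sup>2) x" for x
    using a by (intro continuous_intros) (fastforce simp: complex_eq_iff)
  then have "has_bochner_integral lborel (\<lambda>x. (norm (\<Sum>k\<in>K. R k / (a k + \<i> * of_real x)))\<^sup>2)
    (Re (\<Sum>k\<in>K. \<Sum>l\<in>K. R k * cnj (R l) * (of_real pi / (a k + cnj (a l)))) -
     Re (\<Sum>k\<in>K. \<Sum>l\<in>K. R k * cnj (R l) * (- of_real pi / (a k + cnj (a l)))))"
    by (intro has_bochner_integral_FTC_real_line[OF deriv _ _ bot top]) auto
  also have "Re (\<Sum>k\<in>K. \<Sum>l\<in>K. R k * cnj (R l) * (of_real pi / (a k + cnj (a l)))) = pi * S"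
    unfolding S_def Re_sum sum_distrib_left by (simp only: Re_pi)
  also have "Re (\<Sum>k\<in>K. \<Sum>l\<in>K. R k * cnj (R l) * (- of_real pi / (a k + cnj (a l)))) = - pi * S"
    unfolding S_def Re_sum sum_distrib_left
    by (simp only: Re_pi minus_divide_left[symmetric] mult_minus_right mult_minus_left
        uminus_complex.sel)
  finally show ?thesis by (simp add: S_def mult.assoc)
qed

text \<open>This is the closed form of \<open>1 / (2 pi)\<close> times the integral of the squared
  modulus over the line of abscissa \<open>\<sigma>\<close>. Unlike the supremum in
  \<open>h2_norm\<close>, it can be evaluated directly at \<open>\<sigma> = 0\<close>.\<close>

definition line_energy :: "'k set \<Rightarrow> ('k \<Rightarrow> complex) \<Rightarrow> ('k \<Rightarrow> complex) \<Rightarrow> real \<Rightarrow> real" where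
  "line_energy K R lam \<sigma> =
    Re (\<Sum>k\<in>K. \<Sum>l\<in>K. R k * cnj (R l) / (2 * of_real \<sigma> - lam k - cnj (lam l)))"

lemma has_bochner_integral_line_energy:
  assumes "\<And>k. k \<in> K \<Longrightarrow> Re (lam k) < 0" "0 \<le> \<sigma>"
  shows "has_bochner_integral lborel
    (\<lambda>\<omega>. (norm (\<Sum>k\<in>K. R k / (Complex \<sigma> \<omega> - lam k)))\<^sup>2) (2 * pi * line_energy K R lam \<sigma>)"
proof -
  have "0 < Re (of_real \<sigma> - lam k)" if "k \<in> K" for k
    using assms(1)[OF that] assms(2) by simp
  from has_bochner_integral_norm_partial_fractions[of K "\<lambda>k. of_real \<sigma> - lam k" R, OF this]
  show ?thesis
    by (simp add: line_energy_def Complex_eq algebra_simps)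
qed

lemma has_bochner_integral_nonneg_value:
  fixes f :: "'a \<Rightarrow> real"
  assumes "has_bochner_integral M f x" "\<And>y. 0 \<le> f y"
  shows "0 \<le> x"
  using assms(1) Bochner_Integration.integral_nonneg[of M f] assms(2)
  by (simp add: has_bochner_integral_iff)

lemma line_energy_nonneg:
  assumes "\<And>k. k \<in> K \<Longrightarrow> Re (lam k) < 0" "0 \<le> \<sigma>"
  shows "0 \<le> line_energy K R lam \<sigma>"
proof -
  have "0 \<le> 2 * pi * line_energy K R lam \<sigma>"
    using has_bochner_integral_line_energy[OF assms, where R = R]
    by (rule has_bochner_integral_nonneg_value) simp_all
  then show ?thesis using pi_gt_zero by (auto simp: zero_le_mult_iff)
qed

text \<open>
  The proof compares the energies \<open>\<integral>\<^sub>0\<^sup>\<infinity> e\<^sup>-\<^sup>2\<^sup>\<sigma>\<^sup>t |h(t)|\<^sup>2 dt\<close> of the impulse response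
  \<open>h(t) = \<Sum>\<^sub>k R\<^sub>k exp(\<lambda>\<^sub>k t)\<close> through the primitive \<open>G \<sigma>\<close> of the integrand that vanishes at infinity.
\<close>

lemma line_energy_le:
  assumes lam: "\<And>k. k \<in> K \<Longrightarrow> Re (lam k) < 0" and \<sigma>: "0 \<le> \<sigma>"
  shows "line_energy K R lam \<sigma> \<le> line_energy K R lam 0"
proof -
  \<comment> \<open>Expanding \<open>exp (-2 * s * t) * (norm (h t))\<^sup>2\<close> yields
    exponentials with these exponents. They are also minus the denominators of
    \<open>line_energy\<close>, so the primitive at \<open>t = 0\<close> is minus the
    energy.\<close>
  define m where "m s k l = lam k + cnj (lam l) - 2 * complex_of_real s" for s k l
  define G where "G s t = Re (\<Sum>k\<in>K. \<Sum>l\<in>K. R k * cnj (R l) / m s k l *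
    exp (m s k l * of_real t))" for s t
  define h where "h t = (\<Sum>k\<in>K. R k * exp (lam k * of_real t))" for t :: real
  have m: "Re (m s k l) < 0" if "k \<in> K" "l \<in> K" "0 \<le> s" for s k l
    using lam[OF that(1)] lam[OF that(2)] that(3) by (simp add: m_def)
  have G0: "G s 0 = - line_energy K R lam s" for s
  proof -
    have "m s k l = - (2 * of_real s - lam k - cnj (lam l))" for k l
      by (simp add: m_def)
    then show ?thesis by (simp add: G_def line_energy_def sum_negf del: minus_diff_eq)
  qed
  have dG: "(G s has_real_derivative exp (-2 * s * t) * (norm (h t))\<^sup>2) (at t)" if "0 \<le> s" for s t
  proof -
    have "((\<lambda>t. \<Sum>k\<in>K. \<Sum>l\<in>K. R k * cnj (R l) / m s k l * exp (m s k l * of_real t))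
      has_vector_derivative (\<Sum>k\<in>K. \<Sum>l\<in>K. R k * cnj (R l) / m s k l *
        (exp (m s k l * of_real t) * m s k l))) (at t)"
    proof (intro has_vector_derivative_sum has_vector_derivative_mult_right)
      fix k l
      have "((\<lambda>z. exp (m s k l * z)) has_field_derivative exp (m s k l * of_real t) * m s k l)
        (at (of_real t))"
        by (auto intro!: derivative_eq_intros)
      from has_vector_derivative_real_field[OF this]
      show "((\<lambda>t. exp (m s k l * of_real t)) has_vector_derivative
          exp (m s k l * of_real t) * m s k l) (at t)" .
    qed
    also have "(\<Sum>k\<in>K. \<Sum>l\<in>K. R k * cnj (R l) / m s k l * (exp (m s k l * of_real t) * m s k l))
      = (\<Sum>k\<in>K. \<Sum>l\<in>K. of_real (exp (-2 * s * t)) *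
          ((R k * exp (lam k * of_real t)) * cnj (R l * exp (lam l * of_real t))))"
    proof (intro sum.cong refl)
      fix k l assume kl: "k \<in> K" "l \<in> K"
      have "m s k l \<noteq> 0" using m[OF kl that] by auto
      moreover have "exp (m s k l * of_real t) = of_real (exp (-2 * s * t)) *
          (exp (lam k * of_real t) * cnj (exp (lam l * of_real t)))"
        by (simp add: m_def exp_cnj flip: exp_of_real exp_add) (simp add: algebra_simps)
      ultimately show "R k * cnj (R l) / m s k l * (exp (m s k l * of_real t) * m s k l) =
          of_real (exp (-2 * s * t)) *
          ((R k * exp (lam k * of_real t)) * cnj (R l * exp (lam l * of_real t)))"
        by simp
    qed
    also have "\<dots> = of_real (exp (-2 * s * t) * (norm (h t))\<^sup>2)"
      unfolding of_real_mult h_def norm_sum_power2 by (simp add: sum_distrib_left)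
    finally have "(G s has_vector_derivative Re (of_real (exp (-2 * s * t) * (norm (h t))\<^sup>2))) (at t)"
      unfolding G_def by (rule bounded_linear.has_vector_derivative[OF bounded_linear_Re])
    then show ?thesis
      by (simp add: has_real_derivative_iff_has_vector_derivative)
  qed
  have limG: "(G s \<longlongrightarrow> 0) at_top" if "0 \<le> s" for s
  proof -
    have "((\<lambda>t. exp (m s k l * of_real t)) \<longlongrightarrow> 0) at_top" if "k \<in> K" "l \<in> K" for k l
    proof (rule tendsto_norm_zero_cancel)
      have "filterlim (\<lambda>t. Re (m s k l) * t) at_bot at_top"
        using m[OF that \<open>0 \<le> s\<close>]
        by (intro filterlim_tendsto_neg_mult_at_bot[OF tendsto_const] filterlim_ident)
      from filterlim_compose[OF exp_at_bot this]
      show "((\<lambda>t. norm (exp (m s k l * of_real t))) \<longlongrightarrow> 0) at_top"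
        by simp
    qed
    then have "(G s \<longlongrightarrow> Re (\<Sum>k\<in>K. \<Sum>l\<in>K. R k * cnj (R l) / m s k l * 0)) at_top"
      unfolding G_def by (intro tendsto_Re tendsto_sum tendsto_mult tendsto_const) auto
    then show ?thesis by simp
  qed
  \<comment> \<open>The derivative of the difference is
    \<open>(exp (-2 * \<sigma> * x) - 1) * (norm (h x))\<^sup>2\<close>, which is nonpositive. The
    difference thus descends to its limit 0 and is nonnegative at \<open>t = 0\<close>.\<close>
  have "G \<sigma> 0 - G 0 0 \<ge> G \<sigma> t - G 0 t" if "0 \<le> t" for t
  proof (rule DERIV_nonpos_imp_nonincreasing[OF that])
    fix x :: real assume "0 \<le> x" "x \<le> t"
    moreover have "((\<lambda>t. G \<sigma> t - G 0 t) has_real_derivative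
      exp (-2 * \<sigma> * x) * (norm (h x))\<^sup>2 - exp (-2 * 0 * x) * (norm (h x))\<^sup>2) (at x)"
      by (intro DERIV_diff dG) (use \<sigma> in auto)
    ultimately show "\<exists>y. ((\<lambda>t. G \<sigma> t - G 0 t) has_real_derivative y) (at x) \<and> y \<le> 0"
      using \<sigma> by (intro exI conjI) (auto simp: mult_left_le_one_le)
  qed
  moreover have "((\<lambda>t. G \<sigma> t - G 0 t) \<longlongrightarrow> 0 - 0) at_top"
    by (intro tendsto_diff limG) (use \<sigma> in auto)
  ultimately have "0 \<le> G \<sigma> 0 - G 0 0"
    by (intro tendsto_upperbound[of "\<lambda>t. G \<sigma> t - G 0 t"])
       (auto simp: eventually_at_top_linorder intro!: exI[of _ 0])
  then show ?thesis by (simp add: G0)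
qed

lemma line_energy_tendsto:
  assumes "\<And>k. k \<in> K \<Longrightarrow> Re (lam k) < 0"
  shows "(line_energy K R lam \<longlongrightarrow> line_energy K R lam 0) (at_right 0)"
proof -
  have nz: "2 * of_real 0 - lam k - cnj (lam l) \<noteq> 0" if "k \<in> K" "l \<in> K" for k l
    using assms[OF that(1)] assms[OF that(2)] by (auto simp: complex_eq_iff)
  show ?thesis
    unfolding line_energy_def[abs_def] using nz
    by (intro tendsto_intros) auto
qed

section \<open>Stability of the closed loop\<close>

text \<open>Test the Riccati equation with \<open>x\<close> on both sides. Replacing
  \<open>A\<close> by the closed loop in the two linear terms compensates
  \<open>2 (norm (C *v (P *v x)))\<^sup>2\<close>, which turns the negative quadratic term into a
  positive one.\<close>

lemma riccati_quadratic_form: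
  fixes A :: "real^'n^'n" and B :: "real^'m^'n" and C :: "real^'n^'p"
  assumes "riccati_solution A B C P"
  shows "2 * ((x v* closed_loop A C P) \<bullet> (P *v x)) + (norm (C *v (P *v x)))\<^sup>2 + (norm (x v* B))\<^sup>2 = 0"
proof -
  have sym: "x v* P = P *v x" for x
    using assms by (metis riccati_solution_def psd_def transpose_matrix_vector)
  have quad: "x \<bullet> (P *v (y v* D)) = y \<bullet> (D *v (P *v x))" for D :: "real^'n^'k" and y
    by (metis sym dot_lmul_matrix inner_commute)
  have "A ** P + P ** transpose A - P ** transpose C ** C ** P + B ** transpose B = 0"
    using assms by (simp add: riccati_solution_def)
  then have "x \<bullet> ((A ** P + P ** transpose A - P ** transpose C ** C ** P + B ** transpose B) *v x) = 0"
    by simp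
  then have "x \<bullet> (A *v (P *v x)) + x \<bullet> (P *v (x v* A)) - x \<bullet> (P *v ((C *v (P *v x)) v* C))
      + x \<bullet> (B *v (x v* B)) = 0"
    by (simp add: matrix_vector_mult_add_rdistrib matrix_vector_mult_diff_rdistrib inner_add_right
        inner_diff_right transpose_matrix_vector flip: matrix_vector_mul_assoc)
  then have "2 * ((x v* A) \<bullet> (P *v x)) - (norm (C *v (P *v x)))\<^sup>2 + (norm (x v* B))\<^sup>2 = 0"
    by (simp add: quad power2_norm_eq_inner dot_lmul_matrix)
  moreover have "(x v* closed_loop A C P) \<bullet> (P *v x) = (x v* A) \<bullet> (P *v x) - (norm (C *v (P *v x)))\<^sup>2"
    by (simp add: closed_loop_def gain_def dot_lmul_matrix matrix_vector_mult_diff_rdistrib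
        inner_diff_right flip: matrix_vector_mul_assoc)
       (simp add: quad transpose_matrix_vector power2_norm_eq_inner)
  ultimately show ?thesis by (simp add: inner_commute)
qed

text \<open>A real matrix acts separately on real and imaginary parts, which makes the real
  quadratic form available for complex eigenvectors.\<close>

lemma vector_cmat_mult:
  "w v* cmat X = (\<chi> k. Complex (((\<chi> i. Re (w $ i)) v* X) $ k) (((\<chi> i. Im (w $ i)) v* X) $ k))"
  by (simp add: vec_eq_iff vector_matrix_mult_def complex_eq_iff)

section \<open>Left eigenvectors and the spectrum\<close>

lemma mat_mult_vector: "mat z *v x = z *s x"
  for x :: "'a::semiring_1^'n"
  by (simp add: vec_eq_iff matrix_vector_mult_def mat_def if_distrib[of "\<lambda>t. t * _"] cong: if_cong)

lemma vector_mult_mat: "x v* mat z = z *s x"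
  for x :: "'a::comm_semiring_1^'n"
  by (simp add: vec_eq_iff vector_matrix_mult_def mat_def if_distrib mult.commute cong: if_cong)

lemma vector_matrix_mult_diff: "x v* (X - Y) = x v* X - x v* Y"
  for x :: "'a::comm_ring_1^'n"
  by (simp add: vec_eq_iff vector_matrix_mult_def right_diff_distrib left_diff_distrib sum_subtractf)

text \<open>If \<open>X - mat z\<close> had trivial right kernel it would have a left inverse, which
  for a square matrix is also a right inverse, and then its left kernel would be trivial
  too.\<close>

lemma left_eigenvector_imp_eigenvalue:
  fixes X :: "complex^'n^'n"
  assumes "w v* X = z *s w" "w \<noteq> 0"
  shows "eigenvalue X z"
proof (rule ccontr)
  assume "\<not> eigenvalue X z"
  then have "\<forall>x. (X - mat z) *v x = 0 \<longrightarrow> x = 0"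
    by (metis eigenvalue_def matrix_vector_mult_diff_rdistrib mat_mult_vector right_minus_eq)
  then obtain Y where "Y ** (X - mat z) = mat 1"
    using matrix_left_invertible_ker by blast
  then have "(X - mat z) ** Y = mat 1"
    using matrix_left_right_inverse by blast
  moreover have "w v* (X - mat z) = 0"
    using assms(1) by (simp add: vector_matrix_mult_diff vector_mult_mat)
  ultimately have "w = 0"
    by (metis vector_matrix_mul_assoc vector_matrix_mul_rid vector_matrix_mult_0)
  with assms(2) show False by simp
qed

lemma invertible_resolvent:
  fixes X :: "complex^'n^'n"
  assumes "\<not> eigenvalue X z"
  shows "invertible (mat z - X)"
proof -
  have "\<forall>x. (mat z - X) *v x = 0 \<longrightarrow> x = 0"
    using assms by (metis eigenvalue_def matrix_vector_mult_diff_rdistrib mat_mult_vector right_minus_eq)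
  then show ?thesis
    using matrix_left_invertible_ker invertible_left_inverse by blast
qed

text \<open>Pair a right eigenvector bilinearly with the columns of \<open>W\<close>. Some pairing
  is nonzero since \<open>W\<close> is invertible, and evaluating \<open>cmat X\<close> on either
  side of it equates the two eigenvalues.\<close>

lemma left_eigenbasis_eigenvalue:
  assumes W: "left_eigenbasis X lam W" and "eigenvalue (cmat X) z"
  shows "\<exists>i. z = lam i"
proof -
  obtain x where x: "x \<noteq> 0" "cmat X *v x = z *s x"
    using assms(2) by (auto simp: eigenvalue_def)
  obtain U where "W ** U = mat 1" "U ** W = mat 1"
    using W by (auto simp: left_eigenbasis_def invertible_def)
  then have "x v* W \<noteq> 0"
    using x(1) by (metis vector_matrix_mul_assoc vector_matrix_mul_rid vector_matrix_mult_0)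
  then obtain i where i: "(x v* W) $ i \<noteq> 0" by (auto simp: vec_eq_iff)
  have "column i W v* cmat X = lam i *s column i W"
    using W by (simp add: left_eigenbasis_def)
  then have "lam i * (x v* W) $ i = scalar_product (column i W v* cmat X) x"
    by (simp only:) (simp add: scalar_product_def column_def vector_matrix_mult_def
        sum_distrib_left mult_ac)
  also have "\<dots> = scalar_product (column i W) (cmat X *v x)"
    unfolding scalar_product_def vector_matrix_mult_def matrix_vector_mult_def
    by (simp add: sum_distrib_left sum_distrib_right mult_ac) (rule sum.swap)
  also have "\<dots> = z * (x v* W) $ i"
    by (simp add: x scalar_product_def column_def vector_matrix_mult_def sum_distrib_left mult_ac)
  finally show ?thesis using i by auto
qed

lemma column_nonzero:
  fixes W :: "complex^'n^'n"
  assumes "invertible W"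
  shows "column i W \<noteq> 0"
proof
  assume "column i W = 0"
  then have "W $ k $ i = 0" for k by (simp add: column_def vec_eq_iff)
  then have "(U ** W) $ i $ i = 0" for U by (simp add: matrix_matrix_mult_def)
  moreover obtain U where "U ** W = mat 1" using assms by (auto simp: invertible_def)
  ultimately have "mat 1 $ i $ i = (0 :: complex)" by metis
  then show False by (simp add: mat_def)
qed

lemma closed_loop_left_eigenvalue_Re_neg:
  fixes A :: "real^'n^'n" and B :: "real^'m^'n" and C :: "real^'n^'p"
  assumes st: "stabilizable A B" and ric: "riccati_solution A B C P"
    and w: "w v* cmat (closed_loop A C P) = z *s w" "w \<noteq> 0"
  shows "Re z < 0"
proof (rule ccontr)
  assume z: "\<not> Re z < 0"
  define x y where "x = (\<chi> i. Re (w $ i))" and "y = (\<chi> i. Im (w $ i))"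
  note cm = vector_cmat_mult[of w, folded x_def y_def]
  have psd: "x \<bullet> (P *v x) \<ge> 0" "y \<bullet> (P *v y) \<ge> 0"
    and sym: "y \<bullet> (P *v x) = x \<bullet> (P *v y)"
  proof -
    have "transpose P = P" and nn: "\<And>x. 0 \<le> x \<bullet> (P *v x)"
      using ric by (auto simp: riccati_solution_def psd_def)
    then show "y \<bullet> (P *v x) = x \<bullet> (P *v y)"
      by (metis dot_lmul_matrix transpose_matrix_vector inner_commute)
    show "x \<bullet> (P *v x) \<ge> 0" "y \<bullet> (P *v y) \<ge> 0" by (rule nn)+
  qed
  have ex: "x v* closed_loop A C P = Re z *\<^sub>R x - Im z *\<^sub>R y"
    and ey: "y v* closed_loop A C P = Im z *\<^sub>R x + Re z *\<^sub>R y"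
    using w(1) unfolding cm by (auto simp: vec_eq_iff complex_eq_iff x_def y_def)
  \<comment> \<open>Add the quadratic forms of the real and imaginary parts: the \<open>Im z\<close>
    terms cancel by symmetry of \<open>P\<close>. With \<open>Re z \<ge> 0\<close> all summands are
    nonnegative, so each vanishes.\<close>
  have "2 * Re z * (x \<bullet> (P *v x) + y \<bullet> (P *v y)) + (norm (C *v (P *v x)))\<^sup>2 + (norm (x v* B))\<^sup>2
      + (norm (C *v (P *v y)))\<^sup>2 + (norm (y v* B))\<^sup>2 = 0"
    using riccati_quadratic_form[OF ric, of x] riccati_quadratic_form[OF ric, of y]
    by (simp add: ex ey sym inner_add_left inner_diff_left algebra_simps)
  moreover have "0 \<le> 2 * Re z * (x \<bullet> (P *v x) + y \<bullet> (P *v y))"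
    using z psd by (intro mult_nonneg_nonneg) auto
  ultimately have "(norm (C *v (P *v x)))\<^sup>2 = 0" "(norm (x v* B))\<^sup>2 = 0"
    "(norm (C *v (P *v y)))\<^sup>2 = 0" "(norm (y v* B))\<^sup>2 = 0"
    using zero_le_power2[of "norm (C *v (P *v x))"] zero_le_power2[of "norm (x v* B)"]
      zero_le_power2[of "norm (C *v (P *v y))"] zero_le_power2[of "norm (y v* B)"]
    by linarith+
  then have 0: "C *v (P *v x) = 0" "x v* B = 0" "C *v (P *v y) = 0" "y v* B = 0"
    by simp_all
  have vP: "v v* gain C P = C *v (P *v v)" for v
    using ric by (metis gain_def riccati_solution_def psd_def transpose_matrix_vector
        transpose_transpose matrix_transpose_mul matrix_vector_mul_assoc)
  obtain K where K: "asymptotically_stable (A - B ** K)"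
    using st by (auto simp: stabilizable_def)
  \<comment> \<open>Both sides equal the action of \<open>A\<close>, because \<open>B\<close> and
    the gain annihilate \<open>x\<close> and \<open>y\<close> from the left. Hence \<open>w\<close>
    is a left eigenvector of the stable matrix as well.\<close>
  have "x v* (A - B ** K) = x v* closed_loop A C P" "y v* (A - B ** K) = y v* closed_loop A C P"
    by (simp_all add: closed_loop_def vector_matrix_mult_diff vP 0 flip: vector_matrix_mul_assoc)
  then have "w v* cmat (A - B ** K) = w v* cmat (closed_loop A C P)"
    unfolding cm by simp
  then have "eigenvalue (cmat (A - B ** K)) z"
    using w left_eigenvector_imp_eigenvalue by metis
  with K z show False by (auto simp: asymptotically_stable_def)
qed

lemma closed_loop_poles_Re_neg:
  assumes "stabilizable A B" "riccati_solution A B C P"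
    and "left_eigenbasis (closed_loop A C P) lam W"
  shows "Re (lam i) < 0"
  using assms closed_loop_left_eigenvalue_Re_neg[OF assms(1,2)] column_nonzero
  by (metis left_eigenbasis_def)

section \<open>Realness of the factors\<close>

abbreviation cnj_mat :: "complex^'m^'n \<Rightarrow> complex^'m^'n" where
  "cnj_mat \<equiv> map_matrix cnj"

lemma cnj_mat_simps:
  fixes X :: "complex^'n^'m" and Y :: "complex^'k^'n" and Z Z' :: "complex^'n^'m"
  shows "cnj_mat (X ** Y) = cnj_mat X ** cnj_mat Y"
    and "cnj_mat (Z - Z') = cnj_mat Z - cnj_mat Z'"
    and "cnj_mat (cmat T) = cmat T"
    and "cnj_mat (mat s) = mat (cnj s)"
  by (simp_all add: vec_eq_iff matrix_matrix_mult_def mat_def)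

lemma cnj_mat_matrix_inv:
  fixes X :: "complex^'n^'n"
  assumes "invertible X"
  shows "matrix_inv (cnj_mat X) = cnj_mat (matrix_inv X)"
proof -
  have "cnj_mat X ** cnj_mat (matrix_inv X) = mat 1"
    by (simp add: matrix_inv_cancel[OF assms] cnj_mat_simps flip: cnj_mat_simps(1))
  then show ?thesis
    by (metis invertible_right_inverse matrix_inv_cancel(2) matrix_mul_assoc matrix_mul_lid matrix_mul_rid)
qed

text \<open>All system matrices are real, so conjugation passes through to \<open>s\<close>.
  Invertibility is assumed because \<open>matrix_inv\<close> of a singular matrix is an unspecified
  choice.\<close>

lemma factor_MN_cnj:
  assumes "invertible (mat s - cmat (closed_loop A C P))"
  shows "factor_MN A B C P (cnj s) $ a $ b = cnj (factor_MN A B C P s $ a $ b)"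
proof -
  have inv: "matrix_inv (mat (cnj s) - cmat (closed_loop A C P)) =
      cnj_mat (matrix_inv (mat s - cmat (closed_loop A C P)))"
    using cnj_mat_matrix_inv[OF assms] by (simp add: cnj_mat_simps)
  have "factor_M A C P (cnj s) = cnj_mat (factor_M A C P s)"
    by (simp add: factor_M_def inv cnj_mat_simps)
  moreover have "factor_N A B C P (cnj s) = cnj_mat (factor_N A B C P s)"
    by (simp add: factor_N_def inv cnj_mat_simps)
  ultimately show ?thesis
    by (cases b) (simp_all add: factor_MN_def hcat_def)
qed

section \<open>The \<open>H\<^sub>2\<close> norm of a partial fraction\<close>

lemma norm_matrix_power2:
  fixes X :: "complex^'m^'p"
  shows "(norm X)\<^sup>2 = (\<Sum>a\<in>UNIV. \<Sum>b\<in>UNIV. (norm (X $ a $ b))\<^sup>2)"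
  by (simp add: norm_vec_def L2_set_def sum_nonneg)

lemma line_energy_zero:
  assumes "\<And>k. k \<in> K \<Longrightarrow> Re (lam k) < 0"
  shows "complex_of_real (line_energy K R lam 0) =
    (\<Sum>k\<in>K. R k * cnj (\<Sum>l\<in>K. R l / (- cnj (lam k) - lam l)))"
proof -
  define S where "S = (\<Sum>k\<in>K. \<Sum>l\<in>K. R k * cnj (R l) / (- lam k - cnj (lam l)))"
  have "cnj S = (\<Sum>k\<in>K. \<Sum>l\<in>K. R l * cnj (R k) / (- lam l - cnj (lam k)))"
    by (simp add: S_def mult.commute minus_diff_commute)
  also have "\<dots> = S"
    unfolding S_def by (rule sum.swap)
  finally have "complex_of_real (Re S) = S"
    by (simp add: complex_eq_iff)
  then show ?thesis
    by (simp add: line_energy_def S_def sum_distrib_left)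
qed

lemma h2_norm_partial_fractions:
  fixes H :: "complex \<Rightarrow> complex^'m^'p" and R :: "'p \<Rightarrow> 'm \<Rightarrow> 'k \<Rightarrow> complex"
  assumes lam: "\<And>k. k \<in> K \<Longrightarrow> Re (lam k) < 0"
    and H: "\<And>s a b. 0 < Re s \<Longrightarrow> H s $ a $ b = (\<Sum>k\<in>K. R a b k / (s - lam k))"
  shows "h2_norm H = ennreal (sqrt (\<Sum>a\<in>UNIV. \<Sum>b\<in>UNIV. line_energy K (R a b) lam 0))"
proof -
  define E where "E \<sigma> = (\<Sum>a\<in>UNIV. \<Sum>b\<in>UNIV. line_energy K (R a b) lam \<sigma>)" for \<sigma>
  have E0: "0 \<le> E \<sigma>" and E_le: "E \<sigma> \<le> E 0" if "0 \<le> \<sigma>" for \<sigma>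
    unfolding E_def using lam that
    by (auto intro!: sum_nonneg sum_mono line_energy_nonneg line_energy_le)
  have line: "ennreal (1 / (2 * pi)) * (\<integral>\<^sup>+\<omega>. ennreal ((norm (H (Complex \<sigma> \<omega>)))\<^sup>2) \<partial>lborel)
      = ennreal (E \<sigma>)" if "0 < \<sigma>" for \<sigma>
  proof -
    have "has_bochner_integral lborel (\<lambda>\<omega>. (norm (H (Complex \<sigma> \<omega>)))\<^sup>2)
        (\<Sum>a\<in>UNIV. \<Sum>b\<in>UNIV. 2 * pi * line_energy K (R a b) lam \<sigma>)"
      using that unfolding norm_matrix_power2
      by (simp add: H) (intro has_bochner_integral_sum has_bochner_integral_line_energy; use lam in simp)
    also have "(\<Sum>a\<in>UNIV. \<Sum>b\<in>UNIV. 2 * pi * line_energy K (R a b) lam \<sigma>) = 2 * pi * E \<sigma>"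
      by (simp add: E_def sum_distrib_left)
    finally have "(\<integral>\<^sup>+\<omega>. ennreal ((norm (H (Complex \<sigma> \<omega>)))\<^sup>2) \<partial>lborel) = ennreal (2 * pi * E \<sigma>)"
      by (simp add: has_bochner_integral_iff nn_integral_eq_integral)
    then show ?thesis
      by (simp flip: ennreal_mult')
  qed
  have "(SUP \<sigma>\<in>{0<..}. ennreal (E \<sigma>)) = ennreal (E 0)"
  \<comment> \<open>The abscissa 0 lies outside the range of the supremum: monotonicity gives the
    upper bound, and the limit from the right gives the lower one.\<close>
  proof (rule antisym)
    show "(SUP \<sigma>\<in>{0<..}. ennreal (E \<sigma>)) \<le> ennreal (E 0)"
      by (intro SUP_least ennreal_leI E_le) auto
    have "(E \<longlongrightarrow> E 0) (at_right 0)"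
      unfolding E_def[abs_def] by (intro tendsto_sum line_energy_tendsto lam)
    then have "((\<lambda>\<sigma>. ennreal (E \<sigma>)) \<longlongrightarrow> ennreal (E 0)) (at_right 0)"
      by (rule tendsto_ennrealI)
    moreover have "\<forall>\<^sub>F \<sigma> in at_right 0. ennreal (E \<sigma>) \<le> (SUP \<sigma>\<in>{0<..}. ennreal (E \<sigma>))"
      by (auto simp: eventually_at_filter intro!: always_eventually SUP_upper)
    ultimately show "ennreal (E 0) \<le> (SUP \<sigma>\<in>{0<..}. ennreal (E \<sigma>))"
      by (rule tendsto_upperbound) simp
  qed
  moreover have "(SUP \<sigma>\<in>{0<..}. ennreal (1 / (2 * pi)) *
      (\<integral>\<^sup>+\<omega>. ennreal ((norm (H (Complex \<sigma> \<omega>)))\<^sup>2) \<partial>lborel)) =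
      (SUP \<sigma>\<in>{0<..}. ennreal (E \<sigma>))"
    by (rule SUP_cong) (simp_all only: line greaterThan_iff)
  ultimately show ?thesis
    using E0[of 0] by (simp add: h2_norm_def E_def)
qed

theorem proposition2:
  fixes A :: "real^'n^'n" and B :: "real^'m^'n" and C :: "real^'n^'p"
    and Ah :: "real^'r^'r" and Bh :: "real^'m^'r" and Ch :: "real^'r^'p"
    and P :: "real^'n^'n" and Ph :: "real^'r^'r"
    and W :: "complex^'n^'n" and lam :: "'n \<Rightarrow> complex"
    and Wh :: "complex^'r^'r" and lamh :: "'r \<Rightarrow> complex"
  assumes "stabilizable A B" and "detectable A C"
    and "stabilizable Ah Bh" and "detectable Ah Ch"
    and "riccati_solution A B C P" and "riccati_solution Ah Bh Ch Ph"
    and "left_eigenbasis (closed_loop A C P) lam W"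
    and "left_eigenbasis (closed_loop Ah Ch Ph) lamh Wh"
  shows "h2_gap A B C P Ah Bh Ch Ph < \<infinity> \<and>
    complex_of_real ((enn2real (h2_gap A B C P Ah Bh Ch Ph))\<^sup>2) =
      (\<Sum>i\<in>UNIV. scalar_product (res_c C W i)
         ((factor_MN A B C P (- lam i) - factor_MN Ah Bh Ch Ph (- lam i))
            *v vcat (res_f C P W i) (res_b B W i))) +
      (\<Sum>j\<in>UNIV. scalar_product (res_c Ch Wh j)
         ((factor_MN Ah Bh Ch Ph (- lamh j) - factor_MN A B C P (- lamh j))
            *v vcat (res_f Ch Ph Wh j) (res_b Bh Wh j)))"
proof -
  define H where "H s = factor_MN A B C P s - factor_MN Ah Bh Ch Ph s" for s
  \<comment> \<open>Indexing by the sum type keeps the two families apart even where pole values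
    coincide. The sign of the second system goes into its residues.\<close>
  define pole where "pole = case_sum lam lamh"
  define R where "R a b = case_sum
      (\<lambda>i. res_c C W i $ a * vcat (res_f C P W i) (res_b B W i) $ b)
      (\<lambda>j. - (res_c Ch Wh j $ a * vcat (res_f Ch Ph Wh j) (res_b Bh Wh j) $ b))" for a b
  have lam: "Re (lam i) < 0" for i
    using closed_loop_poles_Re_neg assms by blast
  have lamh: "Re (lamh j) < 0" for j
    using closed_loop_poles_Re_neg assms by blast
  have pole: "Re (pole k) < 0" for k
    by (cases k) (simp_all add: pole_def lam lamh)
  have sum_UNIV: "sum g UNIV = (\<Sum>i\<in>UNIV. g (Inl i)) + (\<Sum>j\<in>UNIV. g (Inr j))"
    for g :: "'n + 'r \<Rightarrow> complex"
    using sum.Plus[of "UNIV :: 'n set" "UNIV :: 'r set" g] by (simp add: UNIV_Plus_UNIV)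
  \<comment> \<open>The constant terms \<open>[I, 0]\<close> of the two pole-residue forms cancel in
    the difference.\<close>
  have H_eq: "H s $ a $ b = (\<Sum>k\<in>UNIV. R a b k / (s - pole k))" if "0 < Re s" for s a b
  proof -
    have "s \<noteq> lam i" for i using lam[of i] that by auto
    moreover have "s \<noteq> lamh j" for j using lamh[of j] that by auto
    ultimately show ?thesis
      using assms by (simp add: H_def sum_UNIV R_def pole_def sum_negf
          factor_MN_pole_residue[of A C P lam W] factor_MN_pole_residue[of Ah Ch Ph lamh Wh])
  qed
  have H_cnj: "cnj (H (cnj s) $ a $ b) = H s $ a $ b" if "0 < Re s" for s a b
  proof -
    have "\<not> eigenvalue (cmat (closed_loop A C P)) s"
      using left_eigenbasis_eigenvalue[OF assms(7)] lam that by (metis less_asym)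
    moreover have "\<not> eigenvalue (cmat (closed_loop Ah Ch Ph)) s"
      using left_eigenbasis_eigenvalue[OF assms(8)] lamh that by (metis less_asym)
    ultimately show ?thesis
      by (simp add: H_def factor_MN_cnj invertible_resolvent)
  qed
  define E where "E = (\<Sum>a\<in>UNIV. \<Sum>b\<in>UNIV. line_energy UNIV (R a b) pole 0)"
  have gap: "h2_gap A B C P Ah Bh Ch Ph = ennreal (sqrt E)"
    unfolding h2_gap_def E_def H_def[symmetric]
    by (rule h2_norm_partial_fractions) (use pole H_eq in auto)
  have "0 \<le> E"
    unfolding E_def using pole by (intro sum_nonneg line_energy_nonneg) auto
  have "complex_of_real (line_energy UNIV (R a b) pole 0) = (\<Sum>k\<in>UNIV. R a b k * H (- pole k) $ a $ b)"
    for a b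
  proof -
    \<comment> \<open>The inner sum is \<open>H\<close> at \<open>cnj (- pole k)\<close>, a point of
      the right half plane where both \<open>H_eq\<close> and \<open>H_cnj\<close> apply.\<close>
    have "cnj (\<Sum>l\<in>UNIV. R a b l / (- cnj (pole k) - pole l)) = H (- pole k) $ a $ b" for k
      using H_eq[of "cnj (- pole k)" a b] H_cnj[of "- pole k" a b] pole[of k] by simp
    then show ?thesis
      using pole by (simp add: line_energy_zero)
  qed
  then have "complex_of_real E = (\<Sum>a\<in>UNIV. \<Sum>b\<in>UNIV. \<Sum>k\<in>UNIV. R a b k * H (- pole k) $ a $ b)"
    by (simp add: E_def)
  also have "\<dots> = (\<Sum>k\<in>UNIV. \<Sum>a\<in>UNIV. \<Sum>b\<in>UNIV. R a b k * H (- pole k) $ a $ b)"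
    by (subst sum.swap[of _ UNIV "UNIV :: ('n + 'r) set"],
        subst sum.swap[of _ UNIV "UNIV :: ('n + 'r) set"]) (rule refl)
  \<comment> \<open>For a fixed pole the residue is a rank-one product, so the sum over entries is a
    bilinear form in \<open>H\<close>. The minus sign of the second family reverses the difference
    there.\<close>
  also have "\<dots> = (\<Sum>i\<in>UNIV. scalar_product (res_c C W i)
         (H (- lam i) *v vcat (res_f C P W i) (res_b B W i))) +
      (\<Sum>j\<in>UNIV. scalar_product (res_c Ch Wh j)
         (- H (- lamh j) *v vcat (res_f Ch Ph Wh j) (res_b Bh Wh j)))"
    by (simp add: sum_UNIV R_def pole_def scalar_product_def matrix_vector_mult_def
        sum_distrib_left mult_ac)
  finally show ?thesis
    using \<open>0 \<le> E\<close> by (simp add: gap H_def)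
qed

end
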